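(* Let $b$ and $n>1$ be positive integers, let $\Bbbk$ be a field, and let $J$ be the kernel of the $\Bbbk$-algebra homomorphism $$\Bbbk[x_1, \ldots, x_n] \to \Bbbk[t^{r_b(0)}\, s, \ldots, t^{r_b(n-1)}\, s];\quad x_i \mapsto t^{r_b(i-1)}\, s,\ i = 1, \ldots, n,$$ where $t$ and $s$ are indeterminates. Then $J$ is minimally generated by the $2\times 2$-minors of $$Y := \left(\begin{array}{cccc} x_1^b & x_2^b & \ldots & x_{n-1}^b \\ x_2 & x_3 & \ldots & x_n \end{array}\right).$$ Moreover, $J$ has a unique minimal system of binomial generators.
   Context: For a positive integer $b$ and $\ell\ge 1$, $r_b(\ell) := \sum_{j=0}^{\ell-1} b^j$, and $r_b(0):=0$. An ideal is minimally generated by a set if the set generates the ideal and no proper subset does. A minimal system of binomial generators is a minimal generating set consisting of binomials; uniqueness is understood up to multiplying the binomials by nonzero scalars of $\Bbbk$ (in particular, up to sign).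
   Formalization: The uniqueness of the minimal system of binomial generators is stated only for b > 1 or n ≤ 4; for b = 1 and n ≥ 5 it is false, since x_1x_5, x_2x_4 and x_3^2 have the same image and x_2x_4 - x_3^2 can be replaced by x_1x_5 - x_3^2. *)

theory Defs
  imports
    "HOL-Library.Poly_Mapping"
    "HOL-Algebra.Ideal"
    "HOL-Algebra.Generated_Rings"
    "Jordan_Normal_Form.Determinant"
    "Jordan_Normal_Form.DL_Submatrix"
begin

section \<open>Polynomial rings\<close>

text \<open>
  A polynomial is a finitely supported map from exponent vectors to coefficients; an exponent
  vector is a finitely supported map from indeterminates to natural numbers.  The type offers all
  of \<open>'v\<close> as indeterminates, \<open>poly_ring V\<close> is the subring of polynomials in the
  indeterminates \<open>V\<close> only.
\<close>

type_synonym ('v, 'k) mpoly = "('v \<Rightarrow>\<^sub>0 nat) \<Rightarrow>\<^sub>0 'k"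

definition poly_ring :: "'v set \<Rightarrow> ('v, 'k::comm_ring_1) mpoly ring" where
  "poly_ring V =
    \<lparr>carrier = {p. \<forall>m\<in>Poly_Mapping.keys p. Poly_Mapping.keys m \<subseteq> V},
     monoid.mult = (*), one = 1, zero = 0, add = (+)\<rparr>"

definition Const :: "'k::comm_ring_1 \<Rightarrow> ('v, 'k) mpoly" where
  "Const c = Poly_Mapping.single 0 c"

definition Var :: "'v \<Rightarrow> ('v, 'k::comm_ring_1) mpoly" where
  "Var v = Poly_Mapping.single (Poly_Mapping.single v 1) 1"

definition subst_hom ::
  "('v \<Rightarrow> ('w, 'k::comm_ring_1) mpoly) \<Rightarrow> ('v, 'k) mpoly \<Rightarrow> ('w, 'k) mpoly" where
  "subst_hom g p =
    (\<Sum>m\<in>Poly_Mapping.keys p. Const (Poly_Mapping.lookup p m) *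
       (\<Prod>v\<in>Poly_Mapping.keys m. g v ^ Poly_Mapping.lookup m v))"

text \<open>The \<open>\<bbbk>\<close>-subalgebra generated by a set of polynomials.\<close>

definition subalgebra_ring :: "('v, 'k::comm_ring_1) mpoly set \<Rightarrow> ('v, 'k) mpoly ring" where
  "subalgebra_ring G =
    (poly_ring UNIV)\<lparr>carrier := generate_ring (poly_ring UNIV) (range Const \<union> G)\<rparr>"


section \<open>Generating sets of ideals\<close>

definition minimally_generates :: "('a, 'm) ring_scheme \<Rightarrow> 'a set \<Rightarrow> 'a set \<Rightarrow> bool" where
  "minimally_generates R B I \<longleftrightarrow>
     B \<subseteq> carrier R \<and> genideal R B = I \<and> (\<forall>C. C \<subset> B \<longrightarrow> genideal R C \<noteq> I)"

text \<open>A binomial has exactly two terms, with arbitrary nonzero coefficients.\<close>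

definition is_binomial :: "('v, 'k::comm_ring_1) mpoly \<Rightarrow> bool" where
  "is_binomial p \<longleftrightarrow> card (Poly_Mapping.keys p) = 2"

definition minimal_binomial_system ::
  "('v, 'k::comm_ring_1) mpoly ring \<Rightarrow> ('v, 'k) mpoly set \<Rightarrow> ('v, 'k) mpoly set \<Rightarrow> bool" where
  "minimal_binomial_system R B I \<longleftrightarrow> minimally_generates R B I \<and> (\<forall>p\<in>B. is_binomial p)"

definition equal_up_to_scalars ::
  "('v, 'k::comm_ring_1) mpoly set \<Rightarrow> ('v, 'k) mpoly set \<Rightarrow> bool" where
  "equal_up_to_scalars B B' \<longleftrightarrow>
     (\<exists>c. (\<forall>p\<in>B. c p \<noteq> 0) \<and> B' = (\<lambda>p. Const (c p) * p) ` B)"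

text \<open>
  For \<open>curve_ideal b n\<close> below, uniqueness fails exactly when \<open>b = 1\<close> and \<open>n \<ge> 5\<close>: then
  \<open>x\<^sub>1 x\<^sub>5\<close>, \<open>x\<^sub>2 x\<^sub>4\<close> and \<open>x\<^sub>3\<^sup>2\<close> have the same image, and any two of the three
  differences of these monomials can be part of a minimal generating set.
\<close>

definition unique_minimal_binomial_system ::
  "('v, 'k::comm_ring_1) mpoly ring \<Rightarrow> ('v, 'k) mpoly set \<Rightarrow> bool" where
  "unique_minimal_binomial_system R I \<longleftrightarrow>
     (\<exists>B. minimal_binomial_system R B I \<and>
          (\<forall>B'. minimal_binomial_system R B' I \<longrightarrow> equal_up_to_scalars B B'))"


section \<open>The ideal and the matrix\<close>

definition repunit :: "nat \<Rightarrow> nat \<Rightarrow> nat" where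
  "repunit b l = (\<Sum>j<l. b ^ j)"

datatype ts = Ind_t | Ind_s

definition curve_monomial :: "nat \<Rightarrow> nat \<Rightarrow> (ts, 'k::comm_ring_1) mpoly" where
  "curve_monomial b i = Var Ind_t ^ repunit b (i - 1) * Var Ind_s"

abbreviation source_ring :: "nat \<Rightarrow> (nat, 'k::comm_ring_1) mpoly ring" where
  "source_ring n \<equiv> poly_ring {1..n}"

abbreviation target_ring :: "nat \<Rightarrow> nat \<Rightarrow> (ts, 'k::comm_ring_1) mpoly ring" where
  "target_ring b n \<equiv> subalgebra_ring (curve_monomial b ` {1..n})"

definition curve_hom :: "nat \<Rightarrow> (nat, 'k::comm_ring_1) mpoly \<Rightarrow> (ts, 'k) mpoly" where
  "curve_hom b = subst_hom (curve_monomial b)"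

definition curve_ideal :: "nat \<Rightarrow> nat \<Rightarrow> (nat, 'k::comm_ring_1) mpoly set" where
  "curve_ideal b n = a_kernel (source_ring n) (target_ring b n) (curve_hom b)"

text \<open>Matrix positions are counted from 0, indeterminates from 1.\<close>

definition Y_matrix :: "nat \<Rightarrow> nat \<Rightarrow> (nat, 'k::comm_ring_1) mpoly mat" where
  "Y_matrix b n =
     mat 2 (n - 1) (\<lambda>(i, j). if i = 0 then Var (j + 1) ^ b else Var (j + 2))"

definition minors :: "nat \<Rightarrow> 'a::comm_ring_1 mat \<Rightarrow> 'a set" where
  "minors k A =
     {det (submatrix A I J) | I J.
        I \<subseteq> {..<dim_row A} \<and> J \<subseteq> {..<dim_col A} \<and> card I = k \<and> card J = k}"


section \<open>Sanity checks\<close>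

lemma poly_ring_simps [simp]:
  "monoid.mult (poly_ring V) = (*)" "one (poly_ring V) = 1"
  "zero (poly_ring V) = 0" "add (poly_ring V) = (+)"
  by (simp_all add: poly_ring_def)

lemma subalgebra_ring_simps [simp]:
  "monoid.mult (subalgebra_ring G) = (*)" "one (subalgebra_ring G) = 1"
  "zero (subalgebra_ring G) = 0" "add (subalgebra_ring G) = (+)"
  by (simp_all add: subalgebra_ring_def)

lemma Const_0 [simp]: "Const 0 = 0"
  by (simp add: Const_def)

lemma Const_1 [simp]: "Const 1 = 1"
  by (simp add: Const_def)

lemma Const_add: "Const (a + b) = Const a + Const b"
  by (simp add: Const_def single_add)

lemma Const_mult: "Const (a * b) = Const a * Const b"
  by (simp add: Const_def mult_single)

lemma in_poly_ring_iff:
  "p \<in> carrier (poly_ring V) \<longleftrightarrow> (\<forall>m\<in>Poly_Mapping.keys p. Poly_Mapping.keys m \<subseteq> V)"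
  by (simp add: poly_ring_def)

lemma keys_nat_add:
  "Poly_Mapping.keys (m + m' :: 'v \<Rightarrow>\<^sub>0 nat) = Poly_Mapping.keys m \<union> Poly_Mapping.keys m'"
  by (auto simp: in_keys_iff lookup_add)

lemma add_in_poly_ring:
  assumes "p \<in> carrier (poly_ring V)" "q \<in> carrier (poly_ring V)"
  shows "p + q \<in> carrier (poly_ring V)"
  using assms Poly_Mapping.keys_add[of p q] by (fastforce simp: in_poly_ring_iff)

lemma mult_in_poly_ring:
  assumes "p \<in> carrier (poly_ring V)" "q \<in> carrier (poly_ring V)"
  shows "p * q \<in> carrier (poly_ring V)"
  unfolding in_poly_ring_iff
proof
  fix m assume "m \<in> Poly_Mapping.keys (p * q)"
  then obtain a c where ac: "a \<in> Poly_Mapping.keys p" "c \<in> Poly_Mapping.keys q" "m = a + c"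
    using keys_mult[of p q] by auto
  then show "Poly_Mapping.keys m \<subseteq> V"
    using assms unfolding in_poly_ring_iff ac(3) keys_nat_add by blast
qed

lemma cring_poly_ring: "cring (poly_ring V)"
proof (rule cringI)
  show "abelian_group (poly_ring V)"
  proof (rule abelian_groupI)
    fix p assume p: "p \<in> carrier (poly_ring V)"
    have "- p \<in> carrier (poly_ring V)"
      using p by (simp add: in_poly_ring_iff in_keys_iff)
    then show "\<exists>q\<in>carrier (poly_ring V). q \<oplus>\<^bsub>poly_ring V\<^esub> p = \<zero>\<^bsub>poly_ring V\<^esub>"
      by (intro bexI[of _ "- p"]) simp_all
  qed (simp_all add: add_in_poly_ring algebra_simps, simp add: in_poly_ring_iff)
  show "Group.comm_monoid (poly_ring V)"
    by (rule comm_monoidI) (simp_all add: mult_in_poly_ring algebra_simps, simp add: in_poly_ring_iff)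
qed (simp add: algebra_simps)

lemma subst_hom_superset:
  assumes "finite K" "Poly_Mapping.keys p \<subseteq> K"
  shows "subst_hom g p = (\<Sum>m\<in>K. Const (Poly_Mapping.lookup p m) *
       (\<Prod>v\<in>Poly_Mapping.keys m. g v ^ Poly_Mapping.lookup m v))"
  unfolding subst_hom_def
  by (rule sum.mono_neutral_left) (use assms in \<open>auto simp: in_keys_iff\<close>)

lemma subst_hom_add: "subst_hom g (p + q) = subst_hom g p + subst_hom g q"
proof -
  let ?K = "Poly_Mapping.keys p \<union> Poly_Mapping.keys q"
  have "Poly_Mapping.keys (p + q) \<subseteq> ?K" by (rule Poly_Mapping.keys_add)
  then show ?thesis
    by (simp add: subst_hom_superset[of ?K] lookup_add Const_add distrib_right sum.distrib)
qed

lemma subst_hom_0 [simp]: "subst_hom g 0 = 0"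
  by (simp add: subst_hom_def)

lemma subst_hom_single:
  "subst_hom g (Poly_Mapping.single m c) =
     Const c * (\<Prod>v\<in>Poly_Mapping.keys m. g v ^ Poly_Mapping.lookup m v)"
  by (subst subst_hom_superset[of "{m}"]) (auto)

lemma subst_hom_Const [simp]: "subst_hom g (Const c) = Const c"
  by (simp add: Const_def[of c] subst_hom_single)

lemma subst_hom_Var [simp]: "subst_hom g (Var v) = g v"
  by (simp add: Var_def subst_hom_single)

lemma monomial_image_add:
  fixes m m' :: "'v \<Rightarrow>\<^sub>0 nat" and g :: "'v \<Rightarrow> 'a::comm_monoid_mult"
  shows "(\<Prod>v\<in>Poly_Mapping.keys (m + m'). g v ^ Poly_Mapping.lookup (m + m') v) =
    (\<Prod>v\<in>Poly_Mapping.keys m. g v ^ Poly_Mapping.lookup m v) *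
    (\<Prod>v\<in>Poly_Mapping.keys m'. g v ^ Poly_Mapping.lookup m' v)"
proof -
  let ?K = "Poly_Mapping.keys m \<union> Poly_Mapping.keys m'"
  have *: "(\<Prod>v\<in>Poly_Mapping.keys l. g v ^ Poly_Mapping.lookup l v) =
           (\<Prod>v\<in>?K. g v ^ Poly_Mapping.lookup l v)"
    if "Poly_Mapping.keys l \<subseteq> ?K" for l
    by (rule prod.mono_neutral_left) (use that in \<open>auto simp: in_keys_iff\<close>)
  show ?thesis
    using *[of "m + m'"] *[of m] *[of m']
    by (simp add: keys_nat_add lookup_add power_add prod.distrib)
qed

lemma mpoly_induct:
  fixes p :: "'a \<Rightarrow>\<^sub>0 'b::comm_monoid_add"
  assumes "P 0" "\<And>m c p. P p \<Longrightarrow> P (Poly_Mapping.single m c + p)"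
  shows "P p"
proof (induction p rule: Poly_Mapping.update_induct)
  case const
  then show ?case by (rule assms)
next
  case (update p m c)
  have "Poly_Mapping.update m c p = Poly_Mapping.single m c + p"
    using update.hyps
    by (intro poly_mapping_eqI) (auto simp: lookup_update lookup_add lookup_single in_keys_iff when_def)
  then show ?case using assms(2) update.IH by simp
qed

lemma subst_hom_mult: "subst_hom g (p * q) = subst_hom g p * subst_hom g q"
proof (induction p rule: mpoly_induct)
  case (2 m c p)
  have "subst_hom g (Poly_Mapping.single m c * q) = subst_hom g (Poly_Mapping.single m c) * subst_hom g q"
  proof (induction q rule: mpoly_induct)
    case (2 m' c' q)
    then show ?case
      by (simp add: distrib_left subst_hom_add mult_single subst_hom_single monomial_image_add
          Const_mult mult_ac)
  qed simp
  then show ?case using 2 by (simp add: distrib_right subst_hom_add)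
qed simp

lemma curve_hom_Var: "curve_hom b (Var i) = Var Ind_t ^ repunit b (i - 1) * Var Ind_s"
  by (simp add: curve_hom_def curve_monomial_def)

lemma curve_hom_Const: "curve_hom b (Const c) = Const c"
  by (simp add: curve_hom_def)

lemma generate_ring_power:
  "p \<in> generate_ring (poly_ring UNIV) H \<Longrightarrow> p ^ k \<in> generate_ring (poly_ring UNIV) H"
  using generate_ring.one[of "poly_ring UNIV" H] generate_ring.eng_mult[of _ "poly_ring UNIV" H]
  by (induction k) auto

lemma generate_ring_prod:
  assumes "\<And>x. x \<in> A \<Longrightarrow> f x \<in> generate_ring (poly_ring UNIV) H"
  shows "prod f A \<in> generate_ring (poly_ring UNIV) H"
  using assms generate_ring.one[of "poly_ring UNIV" H] generate_ring.eng_mult[of _ "poly_ring UNIV" H]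
  by (induction A rule: infinite_finite_induct) auto

lemma generate_ring_sum:
  assumes "\<And>x. x \<in> A \<Longrightarrow> f x \<in> generate_ring (poly_ring UNIV) (range Const \<union> G)"
  shows "sum f A \<in> generate_ring (poly_ring UNIV) (range Const \<union> G)"
proof -
  have "0 \<in> generate_ring (poly_ring UNIV) (range Const \<union> G)"
    using generate_ring.incl[of "Const 0" "range Const \<union> G" "poly_ring UNIV"]
    by (simp del: Const_0) simp
  then show ?thesis
    using assms generate_ring.eng_add[of _ "poly_ring UNIV" "range Const \<union> G"]
    by (induction A rule: infinite_finite_induct) auto
qed

lemma curve_hom_in_target:
  fixes p :: "(nat, 'k::comm_ring_1) mpoly"
  assumes "p \<in> carrier (source_ring n)"
  shows "curve_hom b p \<in> carrier (target_ring b n)"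
proof -
  let ?H = "range Const \<union> curve_monomial b ` {1..n} :: (ts, 'k) mpoly set"
  have "subst_hom (curve_monomial b) p \<in> generate_ring (poly_ring UNIV) ?H"
    unfolding subst_hom_def
  proof (rule generate_ring_sum)
    fix m assume "m \<in> Poly_Mapping.keys p"
    then have m: "Poly_Mapping.keys m \<subseteq> {1..n}"
      using assms by (simp add: in_poly_ring_iff)
    have "Const (Poly_Mapping.lookup p m) \<in> generate_ring (poly_ring UNIV) ?H"
      by (rule generate_ring.incl) simp
    moreover have "(\<Prod>v\<in>Poly_Mapping.keys m. curve_monomial b v ^ Poly_Mapping.lookup m v)
        \<in> generate_ring (poly_ring UNIV) ?H"
      by (intro generate_ring_prod generate_ring_power generate_ring.incl) (use m in auto)
    ultimately show "Const (Poly_Mapping.lookup p m) *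
        (\<Prod>v\<in>Poly_Mapping.keys m. curve_monomial b v ^ Poly_Mapping.lookup m v)
        \<in> generate_ring (poly_ring UNIV) ?H"
      using generate_ring.eng_mult[of _ "poly_ring UNIV" ?H] by simp
  qed
  then show ?thesis by (simp add: curve_hom_def subalgebra_ring_def)
qed

lemma curve_hom_ring_hom: "curve_hom b \<in> Ring.ring_hom (source_ring n) (target_ring b n)"
  using subst_hom_Const[of _ 1]
  by (intro ring_hom_memI curve_hom_in_target)
     (simp_all add: curve_hom_def subst_hom_add subst_hom_mult)

lemma det_2x2:
  assumes "A \<in> carrier_mat 2 2"
  shows "det A = A $$ (0, 0) * A $$ (1, 1) - A $$ (0, 1) * A $$ (1, 0)"
proof -
  have dim: "dim_row A = 2" "dim_col A = 2" using assms by (rule carrier_matD)+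
  have minor: "det (mat_delete A 0 j) = A $$ (1, if j = 0 then 1 else 0)" for j
  proof -
    have "det (mat_delete A 0 j) = mat_delete A 0 j $$ (0, 0)"
      by (rule det_single, rule carrier_matI) (simp_all add: dim)
    also have "\<dots> = A $$ (1, if j = 0 then 1 else 0)"
      unfolding mat_delete_def dim by (subst index_mat(1)) simp_all
    finally show ?thesis .
  qed
  have two: "{..<2} = {0, 1::nat}" by auto
  have "det A = (\<Sum>j<2. A $$ (0, j) * cofactor A 0 j)"
    by (rule laplace_expansion_row[OF assms]) simp
  also have "\<dots> = A $$ (0, 0) * cofactor A 0 0 + A $$ (0, 1) * cofactor A 0 1"
    unfolding two by simp
  also have "\<dots> = A $$ (0, 0) * A $$ (1, 1) - A $$ (0, 1) * A $$ (1, 0)"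
    unfolding cofactor_def minor by simp
  finally show ?thesis .
qed

lemma pick_pair:
  assumes "i < j"
  shows "pick {i, j} 0 = i" "pick {i, j} (Suc 0) = j"
proof -
  have "card {a \<in> {i, j}. a < i} = card ({} :: nat set)"
    by (rule arg_cong[of _ _ card]) (use assms in auto)
  then have "card {a \<in> {i, j}. a < i} = 0" by (simp only: card.empty)
  moreover have "pick {i, j} (card {a \<in> {i, j}. a < i}) = i"
    by (rule pick_card_in_set) simp
  ultimately show "pick {i, j} 0 = i" by (simp only:)
  have "card {a \<in> {i, j}. a < j} = card {i}"
    by (rule arg_cong[of _ _ card]) (use assms in auto)
  then have "card {a \<in> {i, j}. a < j} = Suc 0" 
    by (rule trans) simp
  moreover have "pick {i, j} (card {a \<in> {i, j}. a < j}) = j"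
    by (rule pick_card_in_set) simp
  ultimately show "pick {i, j} (Suc 0) = j" by (simp only:)
qed

lemma minors_2:
  assumes "dim_row A = 2"
  shows "minors 2 A =
    {A $$ (0, i) * A $$ (1, j) - A $$ (0, j) * A $$ (1, i) | i j. i < j \<and> j < dim_col A}"
proof -
  have det: "det (submatrix A {0, 1} {i, j}) =
      A $$ (0, i) * A $$ (1, j) - A $$ (0, j) * A $$ (1, i)"
    if "i < j" "j < dim_col A" for i j
  proof -
    have r: "{k. k < dim_row A \<and> k \<in> {0, 1}} = {0, 1}" using assms by auto
    have c: "{k. k < dim_col A \<and> k \<in> {i, j}} = {i, j}" using that by auto
    have card: "card {k. k < dim_row A \<and> k \<in> {0, 1}} = 2" "card {k. k < dim_col A \<and> k \<in> {i, j}} = 2"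
      unfolding r c using that by auto
    have "submatrix A {0, 1} {i, j} \<in> carrier_mat 2 2"
      using card by (intro carrier_matI) (simp_all only: dim_submatrix)
    moreover have "submatrix A {0, 1} {i, j} $$ (k, l) = A $$ (pick {0, 1} k, pick {i, j} l)"
      if "k < 2" "l < 2" for k l
      by (rule submatrix_index) (simp_all only: card that)
    ultimately show ?thesis
      using \<open>i < j\<close> pick_pair[of 0 1] by (simp add: det_2x2 pick_pair del: pick.simps)
  qed
  have rows: "I = {0, 1}" if "I \<subseteq> {..<2}" "card I = 2" for I :: "nat set"
    using card_subset_eq[of "{..<2}" I] that by auto
  have cols: "\<exists>i j. i < j \<and> J = {i, j}" if "card J = 2" for J :: "nat set"
    using that by (metis card_2_iff insert_commute linorder_neqE_nat)
  have "det (submatrix A I J) \<in>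
      {A $$ (0, i) * A $$ (1, j) - A $$ (0, j) * A $$ (1, i) | i j. i < j \<and> j < dim_col A}"
    if IJ: "I \<subseteq> {..<dim_row A}" "J \<subseteq> {..<dim_col A}" "card I = 2" "card J = 2" for I J
  proof -
    obtain i j where ij: "i < j" "J = {i, j}" using cols IJ(4) by blast
    moreover have "I = {0, 1}" using rows IJ assms by simp
    ultimately show ?thesis using det[of i j] IJ(2) by auto
  qed
  moreover have "A $$ (0, i) * A $$ (1, j) - A $$ (0, j) * A $$ (1, i) \<in> minors 2 A"
    if "i < j" "j < dim_col A" for i j
  proof -
    have "{0, 1} \<subseteq> {..<dim_row A}" "{i, j} \<subseteq> {..<dim_col A}" "card {0, 1::nat} = 2" "card {i, j} = 2"
      using that assms by auto
    then show ?thesis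
      unfolding minors_def det[OF that, symmetric] by blast
  qed
  ultimately show ?thesis
    unfolding minors_def by (intro equalityI subsetI) (elim CollectE exE conjE, simp)+
qed

end

theory Submission
  imports Defs
begin

text \<open>
  The map sends a monomial to a monomial, whose exponents record the total degree and the weight
  in which \<open>x\<^sub>i\<close> counts \<open>r\<^sub>b(i - 1)\<close>.  A polynomial is therefore in the kernel \<open>J\<close> iff its
  coefficients sum to 0 over each fibre, that is, over each set of monomials with a common image.
  Write \<open>T\<^sub>i\<^sub>j = x\<^sub>i\<^sup>b x\<^sub>j\<^sub>+\<^sub>1\<close> and \<open>L\<^sub>i\<^sub>j = x\<^sub>j\<^sup>b x\<^sub>i\<^sub>+\<^sub>1\<close> for the two terms of the minor on the columns
  \<open>i < j\<close>; they are in the same fibre because \<open>r\<^sub>b(l + 1) = b r\<^sub>b(l) + 1\<close>.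

  Everything follows from one normal form.  Call a monomial reduced if no \<open>L\<^sub>i\<^sub>j\<close> divides it.  The
  exponents of a reduced monomial, with that of \<open>x\<^sub>1\<close> left out, are the digits of the greedy expansion of
  its weight in the numbers \<open>r\<^sub>b(1), \<dots>, r\<^sub>b(n - 1)\<close>: the digits below the last place are at most \<open>b\<close>,
  and where such a digit is \<open>b\<close>, there are only zeros below it.  Hence the weight determines these
  exponents, the degree then determines that of \<open>x\<^sub>1\<close>, and a fibre contains at most one reduced monomial (\<open>reduced_unique\<close>).

  Generation: replacing \<open>L\<^sub>i\<^sub>j\<close> by \<open>T\<^sub>i\<^sub>j\<close> moves within a residue class modulo the minors and terminates,
  so every polynomial is congruent to one with reduced monomials, and such a polynomial lies in \<open>J\<close>
  only if it is 0 (\<open>curve_ideal_generated_by_minors\<close>).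

  Minimality: monomials of degree at most \<open>b\<close> are reduced, so \<open>J\<close> starts in degree \<open>b + 1\<close>, the degree
  of the minors.  In its lowest degree an ideal is just the span of its generators, so a linear
  functional on the polynomials of degree \<open>b + 1\<close> that vanishes on all minors but one shows that this one
  cannot be left out (\<open>minors_minimal\<close>).  The functional sums the coefficients of all monomials from which
  the replacements \<open>L \<mapsto> T\<close> lead to the term \<open>L\<close> of the chosen minor.

  Uniqueness: if \<open>b > 1\<close> or \<open>n \<le> 4\<close>, then each \<open>T\<^sub>i\<^sub>j\<close> is reduced.  A further monomial in its fibre is not
  reduced, so for degree reasons it is some \<open>L\<^sub>k\<^sub>l\<close>; then \<open>T\<^sub>k\<^sub>l\<close> is reduced and in the same fibre, thus
  equal to \<open>T\<^sub>i\<^sub>j\<close>.  The fibre is therefore \<open>{T\<^sub>i\<^sub>j, L\<^sub>i\<^sub>j}\<close>, and the only binomials in \<open>J\<close> that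
  can contribute \<open>T\<^sub>i\<^sub>j\<close> are the scalar multiples of the minor (\<open>binomial_generators_contain_minor\<close>).
\<close>

section \<open>Ideals of polynomials cut out in a fixed degree\<close>

definition weight :: "('v \<Rightarrow> nat) \<Rightarrow> ('v \<Rightarrow>\<^sub>0 nat) \<Rightarrow> nat" where
  "weight \<phi> m = (\<Sum>k\<in>Poly_Mapping.keys m. Poly_Mapping.lookup m k * \<phi> k)"

abbreviation mdeg :: "('v \<Rightarrow>\<^sub>0 nat) \<Rightarrow> nat" where
  "mdeg \<equiv> weight (\<lambda>_. Suc 0)"

abbreviation monom :: "('v \<Rightarrow>\<^sub>0 nat) \<Rightarrow> ('v, 'k::comm_ring_1) mpoly" where
  "monom m \<equiv> Poly_Mapping.single m 1"

lemma weight_superset: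
  assumes "finite K" "Poly_Mapping.keys m \<subseteq> K"
  shows "weight \<phi> m = (\<Sum>k\<in>K. Poly_Mapping.lookup m k * \<phi> k)"
  unfolding weight_def
  by (rule sum.mono_neutral_left) (use assms in \<open>auto simp: in_keys_iff\<close>)

lemma weight_zero [simp]: "weight \<phi> 0 = 0"
  by (simp add: weight_def)

lemma weight_single [simp]: "weight \<phi> (Poly_Mapping.single k a) = a * \<phi> k"
  by (subst weight_superset[of "{k}"]) auto

lemma weight_add [simp]: "weight \<phi> (m + m') = weight \<phi> m + weight \<phi> m'"
  using weight_superset[of "Poly_Mapping.keys m \<union> Poly_Mapping.keys m'" _ \<phi>]
  by (simp add: keys_nat_add lookup_add sum.distrib distrib_right)

lemma mdeg_eq_0_iff [simp]: "mdeg m = 0 \<longleftrightarrow> m = 0"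
  by (auto simp: weight_def in_keys_iff intro: poly_mapping_eqI)

lemma lookup_Const_mult:
  "Poly_Mapping.lookup (Const c * p) m = c * Poly_Mapping.lookup p m"
  unfolding Const_def mult_map_scale_conv_mult[symmetric] by (simp add: map.rep_eq when_def)

text \<open>
  In the lowest degree that occurs in a polynomial, a multiple sees only the constant term of the
  cofactor: any other product of terms has larger degree.
\<close>

lemma lookup_mult_lowest_degree:
  fixes p q :: "('v, 'k::comm_ring_1) mpoly"
  assumes "\<And>l. l \<in> Poly_Mapping.keys p \<Longrightarrow> mdeg m \<le> mdeg l"
  shows "Poly_Mapping.lookup (q * p) m = Poly_Mapping.lookup q 0 * Poly_Mapping.lookup p m"
proof -
  define q' where "q' = q - Const (Poly_Mapping.lookup q 0)"
  have q'0: "0 \<notin> Poly_Mapping.keys q'"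
    by (simp add: q'_def in_keys_iff lookup_minus Const_def)
  have "m \<notin> Poly_Mapping.keys (q' * p)"
  proof
    assume "m \<in> Poly_Mapping.keys (q' * p)"
    then obtain a l where al: "a \<in> Poly_Mapping.keys q'" "l \<in> Poly_Mapping.keys p" "m = a + l"
      using keys_mult[of q' p] by auto
    then have "mdeg a = 0" using assms[OF al(2)] by simp
    then show False using al(1) q'0 by simp
  qed
  moreover have "q * p = Const (Poly_Mapping.lookup q 0) * p + q' * p"
    by (simp add: q'_def algebra_simps)
  ultimately show ?thesis
    by (simp add: lookup_add lookup_Const_mult in_keys_iff)
qed

lemma ideal_poly_ringI:
  fixes A :: "('v, 'k::comm_ring_1) mpoly set"
  assumes sub: "A \<subseteq> carrier (poly_ring V)" and zero: "0 \<in> A"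
    and add: "\<And>p q. p \<in> A \<Longrightarrow> q \<in> A \<Longrightarrow> p + q \<in> A"
    and mult: "\<And>p q. p \<in> A \<Longrightarrow> q \<in> carrier (poly_ring V) \<Longrightarrow> q * p \<in> A"
  shows "ideal A (poly_ring V)"
proof -
  interpret cring "poly_ring V :: ('v, 'k) mpoly ring" by (rule cring_poly_ring)
  have one: "(1 :: ('v, 'k) mpoly) \<in> carrier (poly_ring V)"
    using one_closed by simp
  have "\<ominus>\<^bsub>poly_ring V\<^esub> p \<in> A" if p: "p \<in> A" for p
  proof -
    have "\<ominus>\<^bsub>poly_ring V\<^esub> (1 :: ('v, 'k) mpoly) \<in> carrier (poly_ring V)" using one by (rule a_inv_closed)
    then have "\<ominus>\<^bsub>poly_ring V\<^esub> 1 * p \<in> A" using mult p by blast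
    moreover have "\<ominus>\<^bsub>poly_ring V\<^esub> 1 * p = \<ominus>\<^bsub>poly_ring V\<^esub> p"
      using l_minus[OF one, of p] p sub by auto
    ultimately show ?thesis by simp
  qed
  then have "subgroup A (add_monoid (poly_ring V))"
    by (intro add.subgroupI) (use sub zero add in \<open>auto simp: a_inv_def\<close>)
  then show ?thesis
    by (intro idealI) (use mult ring_axioms in \<open>auto simp: mult.commute\<close>)
qed

context
  fixes V :: "'v set" and A :: "('v, 'k::comm_ring_1) mpoly set"
  assumes ideal: "ideal A (poly_ring V)"
begin

lemma ideal_poly_ring_zero: "0 \<in> A"
  using additive_subgroup.zero_closed[OF ideal.axioms(1)[OF ideal]] by simp

lemma ideal_poly_ring_add: "p \<in> A \<Longrightarrow> q \<in> A \<Longrightarrow> p + q \<in> A"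
  using additive_subgroup.a_closed[OF ideal.axioms(1)[OF ideal]] by simp

lemma ideal_poly_ring_mult: "p \<in> A \<Longrightarrow> q \<in> carrier (poly_ring V) \<Longrightarrow> q * p \<in> A"
  using ideal.I_l_closed[OF ideal] by simp

lemma ideal_poly_ring_sum: "(\<And>x. x \<in> X \<Longrightarrow> f x \<in> A) \<Longrightarrow> sum f X \<in> A"
  by (induction X rule: infinite_finite_induct)
     (auto intro: ideal_poly_ring_zero ideal_poly_ring_add)

end

lemma genideal_ideal_poly_ring:
  assumes "B \<subseteq> carrier (poly_ring V)"
  shows "ideal (genideal (poly_ring V) B) (poly_ring V)"
  by (rule ring.genideal_ideal[OF cring.axioms(1)[OF cring_poly_ring] assms])

lemma genideal_poly_ring_self:
  assumes "B \<subseteq> carrier (poly_ring V)"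
  shows "B \<subseteq> genideal (poly_ring V) B"
  by (rule ring.genideal_self[OF cring.axioms(1)[OF cring_poly_ring] assms])

lemma genideal_poly_ring_minimal:
  assumes "ideal I (poly_ring V)" "B \<subseteq> I"
  shows "genideal (poly_ring V) B \<subseteq> I"
  by (rule ring.genideal_minimal[OF cring.axioms(1)[OF cring_poly_ring] assms])

lemma Const_in_poly_ring: "Const c \<in> carrier (poly_ring V)"
  by (simp add: in_poly_ring_iff Const_def)

lemma monom_in_poly_ring: "Poly_Mapping.keys m \<subseteq> V \<Longrightarrow> monom m \<in> carrier (poly_ring V)"
  by (simp add: in_poly_ring_iff)

lemma diff_in_poly_ring:
  assumes "p \<in> carrier (poly_ring V)" "q \<in> carrier (poly_ring V)"
  shows "p - q \<in> carrier (poly_ring V)"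
  using assms Poly_Mapping.keys_diff[of p q] by (fastforce simp: in_poly_ring_iff)

text \<open>
  These ideals separate: if the generators lie in one of them and some polynomial does not, then
  that polynomial is not generated.
\<close>

definition degree_functional_ideal ::
  "'v set \<Rightarrow> nat \<Rightarrow> ('v \<Rightarrow>\<^sub>0 nat) set \<Rightarrow> ('v, 'k::comm_ring_1) mpoly set" where
  "degree_functional_ideal V d S = {p \<in> carrier (poly_ring V).
     (\<forall>m\<in>Poly_Mapping.keys p. d \<le> mdeg m) \<and> (\<Sum>m\<in>S. Poly_Mapping.lookup p m) = 0}"

text \<open>
  A multiple has the degree \<open>d\<close> coefficients of the polynomial, all scaled by the constant term of the
  cofactor, so the sum stays zero.
\<close>

lemma ideal_degree_functional_ideal:
  assumes "\<And>m. m \<in> S \<Longrightarrow> mdeg m = d"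
  shows "ideal (degree_functional_ideal V d S :: ('v, 'k::comm_ring_1) mpoly set) (poly_ring V)"
proof (rule ideal_poly_ringI)
  fix p q :: "('v, 'k) mpoly"
  assume p: "p \<in> degree_functional_ideal V d S" and q: "q \<in> carrier (poly_ring V)"
  have "d \<le> mdeg m" if m: "m \<in> Poly_Mapping.keys (q * p)" for m
  proof -
    obtain a l where "l \<in> Poly_Mapping.keys p" "m = a + l"
      using m keys_mult[of q p] by blast
    then show ?thesis using p by (fastforce simp: degree_functional_ideal_def)
  qed
  moreover have "(\<Sum>m\<in>S. Poly_Mapping.lookup (q * p) m) =
      (\<Sum>m\<in>S. Poly_Mapping.lookup q 0 * Poly_Mapping.lookup p m)"
    by (intro sum.cong refl lookup_mult_lowest_degree)
       (use p assms in \<open>auto simp: degree_functional_ideal_def\<close>)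
  ultimately show "q * p \<in> degree_functional_ideal V d S"
    using p q mult_in_poly_ring
    by (auto simp: degree_functional_ideal_def sum_distrib_left[symmetric])
next
  fix p q :: "('v, 'k) mpoly"
  assume "p \<in> degree_functional_ideal V d S" "q \<in> degree_functional_ideal V d S"
  then show "p + q \<in> degree_functional_ideal V d S"
    using Poly_Mapping.keys_add[of p q] add_in_poly_ring[of p V q]
    by (auto simp: degree_functional_ideal_def lookup_add sum.distrib)
qed (auto simp: degree_functional_ideal_def in_poly_ring_iff)


section \<open>The kernel\<close>

abbreviation t_weight :: "nat \<Rightarrow> (nat \<Rightarrow>\<^sub>0 nat) \<Rightarrow> nat" where
  "t_weight b \<equiv> weight (\<lambda>i. repunit b (i - 1))"

definition image_exponent :: "nat \<Rightarrow> (nat \<Rightarrow>\<^sub>0 nat) \<Rightarrow> (ts \<Rightarrow>\<^sub>0 nat)" where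
  "image_exponent b m =
     Poly_Mapping.single Ind_t (t_weight b m) + Poly_Mapping.single Ind_s (mdeg m)"

lemma image_exponent_eq_iff:
  "image_exponent b m = image_exponent b m' \<longleftrightarrow> t_weight b m = t_weight b m' \<and> mdeg m = mdeg m'"
proof
  assume "image_exponent b m = image_exponent b m'"
  then have "Poly_Mapping.lookup (image_exponent b m) v = Poly_Mapping.lookup (image_exponent b m') v" for v
    by simp
  from this[of Ind_t] this[of Ind_s] show "t_weight b m = t_weight b m' \<and> mdeg m = mdeg m'"
    by (simp add: image_exponent_def lookup_add lookup_single)
qed (simp add: image_exponent_def)

lemma Var_power: "Var v ^ k = monom (Poly_Mapping.single v k)"
  by (induction k) (simp_all add: Var_def mult_single single_add[symmetric])

lemma curve_monomial_power:
  "(curve_monomial b i :: (ts, 'k::comm_ring_1) mpoly) ^ a =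
     monom (image_exponent b (Poly_Mapping.single i a))"
  by (simp only: curve_monomial_def power_mult_distrib power_mult[symmetric])
     (simp add: Var_power mult_single image_exponent_def mult.commute add.commute)

lemma curve_hom_single:
  "curve_hom b (Poly_Mapping.single m c) = Poly_Mapping.single (image_exponent b m) (c :: 'k::comm_ring_1)"
proof -
  have "(\<Prod>v\<in>K. curve_monomial b v ^ Poly_Mapping.lookup m v) =
      (monom (\<Sum>v\<in>K. image_exponent b (Poly_Mapping.single v (Poly_Mapping.lookup m v)))
        :: (ts, 'k) mpoly)"
    if "finite K" for K
    using that
    by (induction K) (auto simp: curve_monomial_power mult_single)
  moreover have "(\<Sum>v\<in>Poly_Mapping.keys m. image_exponent b (Poly_Mapping.single v (Poly_Mapping.lookup m v)))
      = image_exponent b m"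
    by (intro poly_mapping_eqI)
       (simp add: image_exponent_def weight_def[of _ m] lookup_sum lookup_add lookup_single sum.distrib when_def)
  ultimately show ?thesis
    by (simp add: curve_hom_def subst_hom_single Const_def mult_single)
qed

lemma curve_hom_0: "curve_hom b 0 = 0"
  by (simp add: curve_hom_def)

lemma curve_hom_add: "curve_hom b (p + q) = curve_hom b p + curve_hom b q"
  by (simp add: curve_hom_def subst_hom_add)

lemma curve_hom_mult: "curve_hom b (p * q) = curve_hom b p * curve_hom b q"
  by (simp add: curve_hom_def subst_hom_mult)

lemma curve_hom_diff:
  fixes p q :: "(nat, 'k::comm_ring_1) mpoly"
  shows "curve_hom b (p - q) = curve_hom b p - curve_hom b q"
  using curve_hom_add[of b "p - q" q] by simp

lemma lookup_curve_hom:
  fixes p :: "(nat, 'k::comm_ring_1) mpoly"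
  shows "Poly_Mapping.lookup (curve_hom b p) e =
    (\<Sum>m\<in>{m\<in>Poly_Mapping.keys p. image_exponent b m = e}. Poly_Mapping.lookup p m)"
proof -
  have "curve_hom b p = (\<Sum>m\<in>Poly_Mapping.keys p. curve_hom b (Poly_Mapping.single m (Poly_Mapping.lookup p m)))"
    unfolding curve_hom_def by (subst subst_hom_def) (simp add: subst_hom_single)
  then show ?thesis
    by (simp add: curve_hom_single lookup_sum lookup_single when_def sum.If_cases Int_def)
qed

lemma curve_ideal_eq: "curve_ideal b n = {p \<in> carrier (source_ring n). curve_hom b p = 0}"
  by (simp add: curve_ideal_def a_kernel_def')

lemma ideal_curve_ideal: "ideal (curve_ideal b n) (source_ring n)"
  by (rule ideal_poly_ringI)
     (auto simp: curve_ideal_eq curve_hom_add curve_hom_mult add_in_poly_ring mult_in_poly_ring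
        in_poly_ring_iff[of 0] curve_hom_0)

text \<open>
  A term that is alone in its fibre would survive in the image.
\<close>

lemma curve_ideal_key_not_alone:
  assumes "p \<in> curve_ideal b n" "m \<in> Poly_Mapping.keys p"
  obtains m' where "m' \<in> Poly_Mapping.keys p" "m' \<noteq> m" "image_exponent b m' = image_exponent b m"
proof (rule ccontr)
  assume "\<not> thesis"
  with that assms(2) have "{l\<in>Poly_Mapping.keys p. image_exponent b l = image_exponent b m} = {m}" by blast
  then have "Poly_Mapping.lookup p m = 0"
    using lookup_curve_hom[of b p "image_exponent b m"] assms(1) by (simp add: curve_ideal_eq)
  then show False using assms(2) by (simp add: in_keys_iff)
qed

lemma curve_ideal_key_closed:
  "p \<in> curve_ideal b n \<Longrightarrow> m \<in> Poly_Mapping.keys p \<Longrightarrow> Poly_Mapping.keys m \<subseteq> {1..n}"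
  by (auto simp: curve_ideal_eq in_poly_ring_iff)


section \<open>The terms of the minors\<close>

text \<open>
  The exponent vectors of the products along the main diagonal and along the antidiagonal of the
  submatrix of \<open>Y\<close> on the columns \<open>i < j\<close>.
\<close>

definition diag_term :: "nat \<Rightarrow> nat \<Rightarrow> nat \<Rightarrow> (nat \<Rightarrow>\<^sub>0 nat)" where
  "diag_term b i j = Poly_Mapping.single i b + Poly_Mapping.single (j + 1) 1"

definition anti_term :: "nat \<Rightarrow> nat \<Rightarrow> nat \<Rightarrow> (nat \<Rightarrow>\<^sub>0 nat)" where
  "anti_term b i j = Poly_Mapping.single j b + Poly_Mapping.single (i + 1) 1"

definition column_pair :: "nat \<Rightarrow> nat \<Rightarrow> nat \<Rightarrow> bool" where
  "column_pair n i j \<longleftrightarrow> 1 \<le> i \<and> i < j \<and> j < n"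

lemma minors_Y_matrix:
  "minors 2 (Y_matrix b n) =
     ({monom (diag_term b i j) - monom (anti_term b i j) | i j. column_pair n i j}
       :: (nat, 'k::comm_ring_1) mpoly set)"
proof -
  let ?Y = "Y_matrix b n :: (nat, 'k) mpoly mat"
  have Collect_eq: "{f i j | i j. P i j} = {g i j | i j. P i j}" if "\<And>i j. P i j \<Longrightarrow> f i j = g i j"
    for f g :: "nat \<Rightarrow> nat \<Rightarrow> (nat, 'k) mpoly" and P
    using that by (metis (no_types, lifting))
  have dim: "dim_row ?Y = 2" "dim_col ?Y = n - 1" by (simp_all add: Y_matrix_def)
  have "minors 2 ?Y =
      {monom (diag_term b (i + 1) (j + 1)) - monom (anti_term b (i + 1) (j + 1)) | i j. i < j \<and> j < n - 1}"
    unfolding minors_2[OF dim(1)] dim(2)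
    by (rule Collect_eq)
       (simp add: Y_matrix_def Var_power, simp add: Var_def mult_single diag_term_def anti_term_def)
  also have "\<dots> = {monom (diag_term b i j) - monom (anti_term b i j) | i j. column_pair n i j}"
  proof -
    have "column_pair n i j \<Longrightarrow> \<exists>i' j'. i = i' + 1 \<and> j = j' + 1 \<and> i' < j' \<and> j' < n - 1" for i j
      by (intro exI[of _ "i - 1"] exI[of _ "j - 1"]) (auto simp: column_pair_def)
    moreover have "i < j \<and> j < n - 1 \<Longrightarrow> column_pair n (i + 1) (j + 1)" for i j
      by (auto simp: column_pair_def)
    ultimately show ?thesis by (intro equalityI subsetI) (elim CollectE exE conjE; blast)+
  qed
  finally show ?thesis .
qed

lemma repunit_Suc: "repunit b (Suc l) = b * repunit b l + 1"
  unfolding repunit_def sum.lessThan_Suc_shift by (simp add: sum_distrib_left)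

lemma mdeg_minor_terms [simp]: "mdeg (diag_term b i j) = b + 1" "mdeg (anti_term b i j) = b + 1"
  by (simp_all add: diag_term_def anti_term_def)

lemma keys_minor_terms:
  assumes "column_pair n i j"
  shows "Poly_Mapping.keys (diag_term b i j) \<subseteq> {1..n}" "Poly_Mapping.keys (anti_term b i j) \<subseteq> {1..n}"
  using assms by (auto simp: diag_term_def anti_term_def keys_nat_add column_pair_def)

lemma image_exponent_minor_terms:
  assumes "column_pair n i j"
  shows "image_exponent b (diag_term b i j) = image_exponent b (anti_term b i j)"
proof -
  obtain i' j' where "i = Suc i'" "j = Suc j'"
    using assms by (cases i; cases j) (auto simp: column_pair_def)
  then show ?thesis
    by (simp add: image_exponent_eq_iff) (simp add: diag_term_def anti_term_def repunit_Suc)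
qed

text \<open>
  The exponential growth makes this weight increase when the antidiagonal term of a minor is
  replaced by the diagonal one: it gains \<open>(b + 1)\<^sup>j\<close> and loses \<open>(b + 1)\<^sup>i\<close>, where \<open>i < j\<close>.
\<close>

abbreviation lift_weight :: "nat \<Rightarrow> (nat \<Rightarrow>\<^sub>0 nat) \<Rightarrow> nat" where
  "lift_weight b \<equiv> weight (\<lambda>k. (b + 1) ^ k)"

lemma lift_weight_anti_less_diag:
  assumes "b \<ge> 1" "column_pair n i j"
  shows "lift_weight b (anti_term b i j) < lift_weight b (diag_term b i j)"
proof -
  have "(b + 1) ^ i < (b + 1) ^ j"
    using assms by (intro power_strict_increasing) (auto simp: column_pair_def)
  then show ?thesis by (simp add: diag_term_def anti_term_def)
qed

lemma anti_term_inject: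
  assumes "b \<ge> 1" "column_pair n i j" "column_pair n i' j'"
    and "anti_term b i j = anti_term b i' j'"
  shows "i = i'" "j = j'"
proof -
  have eq: "(if k = j then b else 0) + (if k = i + 1 then 1 else 0) =
      (if k = j' then b else 0) + (if k = i' + 1 then 1 else 0)" for k
    using arg_cong[OF assms(4), of "\<lambda>m. Poly_Mapping.lookup m k"]
    by (auto simp: anti_term_def lookup_add lookup_single when_def split: if_splits)
  show "j = j'"
    using eq[of j] eq[of j'] assms(1-3) by (auto simp: column_pair_def split: if_splits)
  then show "i = i'"
    using eq[of "i + 1"] by (auto split: if_splits)
qed

lemma diag_term_inject:
  assumes "b \<ge> 1" "column_pair n i j" "column_pair n i' j'"
    and "diag_term b i j = diag_term b i' j'"
  shows "i = i'" "j = j'"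
proof -
  have eq: "(if k = i then b else 0) + (if k = j + 1 then 1 else 0) =
      (if k = i' then b else 0) + (if k = j' + 1 then 1 else 0)" for k
    using arg_cong[OF assms(4), of "\<lambda>m. Poly_Mapping.lookup m k"]
    by (auto simp: diag_term_def lookup_add lookup_single when_def split: if_splits)
  show "i = i'"
    using eq[of i] eq[of i'] assms(1-3) by (auto simp: column_pair_def split: if_splits)
  then show "j = j'"
    using eq[of "j + 1"] by (auto split: if_splits)
qed


section \<open>Reduced monomials\<close>

text \<open>
  The monomials to which the replacement of antidiagonal by diagonal terms does not apply.
\<close>

definition reduced :: "nat \<Rightarrow> nat \<Rightarrow> (nat \<Rightarrow>\<^sub>0 nat) \<Rightarrow> bool" where
  "reduced b n m \<longleftrightarrow> (\<forall>i j q. column_pair n i j \<longrightarrow> m \<noteq> anti_term b i j + q)"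

text \<open>
  The digit sequences that the greedy algorithm for expansions in the numbers \<open>repunit b l\<close> produces
  at the places \<open>1, \<dots>, N - 1\<close>.  The place 0 is left free, since \<open>repunit b 0 = 0\<close>.
\<close>

definition greedy :: "nat \<Rightarrow> (nat \<Rightarrow> nat) \<Rightarrow> nat \<Rightarrow> bool" where
  "greedy b a N \<longleftrightarrow>
     (\<forall>l. 1 \<le> l \<and> l < N \<longrightarrow> a l \<le> b \<and> (a l = b \<longrightarrow> (\<forall>k. 1 \<le> k \<and> k < l \<longrightarrow> a k = 0)))"

lemma greedy_antimono: "greedy b a N \<Longrightarrow> N' \<le> N \<Longrightarrow> greedy b a N'"
  unfolding greedy_def using less_le_trans by blast

text \<open>
  A top digit \<open>b\<close> contributes \<open>b * repunit b N = repunit b (Suc N) - 1\<close>, which leaves no room for a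
  nonzero lower digit; this is why the rule for digits \<open>b\<close> is the right one.
\<close>

lemma greedy_sum_less:
  assumes "greedy b a N" "N \<ge> 1"
  shows "(\<Sum>l<N. a l * repunit b l) < repunit b N"
  using assms(2,1)
proof (induction N rule: nat_induct_at_least)
  case base
  then show ?case by (simp add: repunit_def)
next
  case (Suc N)
  have "greedy b a N" using Suc.prems greedy_antimono le_SucI order_refl by blast
  then have IH: "(\<Sum>l<N. a l * repunit b l) < repunit b N" by (rule Suc.IH)
  have top: "a N \<le> b" "a N = b \<Longrightarrow> \<forall>k. 1 \<le> k \<and> k < N \<longrightarrow> a k = 0"
    using Suc by (auto simp: greedy_def)
  show ?case
  proof (cases "a N = b")
    case True
    have "(\<Sum>l<N. a l * repunit b l) = 0"
    proof (intro sum.neutral ballI)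
      fix l assume "l \<in> {..<N}"
      then show "a l * repunit b l = 0"
        using top(2)[OF True] by (cases l) (auto simp: repunit_def)
    qed
    then show ?thesis using True by (simp add: repunit_Suc)
  next
    case False
    then have "Suc (a N) * repunit b N \<le> b * repunit b N"
      using top(1) by (intro mult_right_mono) auto
    then show ?thesis using IH by (simp add: repunit_Suc)
  qed
qed

text \<open>
  The top digit, at place \<open>N\<close>, is unrestricted: by the bound on the lower part it is a quotient of a
  division with remainder, and the remaining digits follow by induction.
\<close>

lemma greedy_unique:
  assumes "greedy b a N" "greedy b c N"
    and "(\<Sum>l<Suc N. a l * repunit b l) = (\<Sum>l<Suc N. c l * repunit b l)"
  shows "\<forall>l. 1 \<le> l \<and> l \<le> N \<longrightarrow> a l = c l"
  using assms
proof (induction N)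
  case (Suc N)
  have less: "(\<Sum>l<Suc N. a l * repunit b l) < repunit b (Suc N)"
    "(\<Sum>l<Suc N. c l * repunit b l) < repunit b (Suc N)"
    using greedy_sum_less[OF Suc.prems(1)] greedy_sum_less[OF Suc.prems(2)] by simp_all
  have eq: "(\<Sum>l<Suc N. a l * repunit b l) + a (Suc N) * repunit b (Suc N) =
      (\<Sum>l<Suc N. c l * repunit b l) + c (Suc N) * repunit b (Suc N)"
    using Suc.prems(3) by (simp only: sum.lessThan_Suc[of _ "Suc N"])
  have "a (Suc N) = ((\<Sum>l<Suc N. a l * repunit b l) + a (Suc N) * repunit b (Suc N)) div repunit b (Suc N)"
    using less(1) by (simp only: div_mult_self1 div_less)
  also have "\<dots> = c (Suc N)"
    unfolding eq using less(2) by (simp only: div_mult_self1 div_less)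
  finally have top: "a (Suc N) = c (Suc N)" .
  moreover have "\<forall>l. 1 \<le> l \<and> l \<le> N \<longrightarrow> a l = c l"
  proof (rule Suc.IH)
    show "greedy b a N" "greedy b c N" using Suc.prems(1,2) greedy_antimono le_SucI order_refl by blast+
    show "(\<Sum>l<Suc N. a l * repunit b l) = (\<Sum>l<Suc N. c l * repunit b l)"
      using eq unfolding top by (rule add_right_imp_eq)
  qed
  ultimately show ?case using le_Suc_eq by auto
qed simp

text \<open>
  The digit at a place \<open>l\<close> is the exponent of \<open>x\<^sub>j\<close> for \<open>j = l + 1\<close>.  If \<open>x\<^sub>j\<close> had an exponent
  above \<open>b\<close>, the antidiagonal term \<open>x\<^sub>j\<^sup>b x\<^sub>j\<close> of the columns \<open>j - 1 < j\<close>
  would divide the monomial; if it has exponent \<open>b\<close> and some \<open>x\<^sub>i\<^sub>+\<^sub>1\<close> with \<open>1 \<le> i < j - 1\<close> occurs, then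
  \<open>x\<^sub>j\<^sup>b x\<^sub>i\<^sub>+\<^sub>1\<close> divides it.  The last variable \<open>x\<^sub>n\<close> is the unrestricted top digit, as it does not occur in
  the first row of the matrix.
\<close>

lemma reduced_greedy:
  assumes "reduced b n m"
  shows "greedy b (\<lambda>l. Poly_Mapping.lookup m (Suc l)) (n - 1)"
proof -
  have split: "m = l + (m - l)" if "\<And>k. Poly_Mapping.lookup l k \<le> Poly_Mapping.lookup m k" for l
    using that by (intro poly_mapping_eqI) (simp add: lookup_add lookup_minus)
  have no: "\<not> (\<forall>k. Poly_Mapping.lookup (anti_term b i j) k \<le> Poly_Mapping.lookup m k)"
    if "column_pair n i j" for i j
    using assms split that unfolding reduced_def by metis
  have le: "Poly_Mapping.lookup m (Suc l) \<le> b" if "1 \<le> l" "l < n - 1" for l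
  proof (rule ccontr)
    assume "\<not> ?thesis"
    then have "\<forall>k. Poly_Mapping.lookup (anti_term b l (Suc l)) k \<le> Poly_Mapping.lookup m k"
      by (auto simp: anti_term_def lookup_add lookup_single when_def)
    then show False using no that by (auto simp: column_pair_def)
  qed
  moreover have "Poly_Mapping.lookup m (Suc k) = 0"
    if "1 \<le> l" "l < n - 1" "Poly_Mapping.lookup m (Suc l) = b" "1 \<le> k" "k < l" for l k
  proof (rule ccontr)
    assume "\<not> ?thesis"
    then have "\<forall>k'. Poly_Mapping.lookup (anti_term b k (Suc l)) k' \<le> Poly_Mapping.lookup m k'"
      using that by (auto simp: anti_term_def lookup_add lookup_single when_def)
    then show False using no that by (auto simp: column_pair_def)
  qed
  ultimately show ?thesis unfolding greedy_def by auto
qed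

lemma weight_sum_lessThan:
  assumes "Poly_Mapping.keys m \<subseteq> {1..n}"
  shows "weight \<phi> m = (\<Sum>l<n. Poly_Mapping.lookup m (Suc l) * \<phi> (Suc l))"
  using assms by (subst weight_superset[of "{1..n}"]) (simp_all add: sum.atLeast1_atMost_eq)

text \<open>
  The weight fixes the exponents of \<open>x\<^sub>2, \<dots>, x\<^sub>n\<close> as digits of an expansion; \<open>x\<^sub>1\<close> has weight 0, and its
  exponent comes from the degree.
\<close>

lemma reduced_unique:
  assumes "reduced b n m" "reduced b n m'"
    and keys: "Poly_Mapping.keys m \<subseteq> {1..n}" "Poly_Mapping.keys m' \<subseteq> {1..n}"
    and img: "image_exponent b m = image_exponent b m'"
  shows "m = m'"
proof (cases n)
  case 0
  then show ?thesis using keys by simp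
next
  case (Suc N)
  let ?a = "\<lambda>l. Poly_Mapping.lookup m (Suc l)" and ?c = "\<lambda>l. Poly_Mapping.lookup m' (Suc l)"
  have "(\<Sum>l<Suc N. ?a l * repunit b l) = (\<Sum>l<Suc N. ?c l * repunit b l)"
    using img weight_sum_lessThan[OF keys(1)] weight_sum_lessThan[OF keys(2)]
    unfolding image_exponent_eq_iff Suc by simp
  then have high: "\<forall>l. 1 \<le> l \<and> l \<le> N \<longrightarrow> ?a l = ?c l"
    using greedy_unique[of b ?a N ?c] reduced_greedy[OF assms(1)] reduced_greedy[OF assms(2)] Suc
    by simp
  have "(\<Sum>l<Suc N. ?a l) = (\<Sum>l<Suc N. ?c l)"
    using img weight_sum_lessThan[OF keys(1)] weight_sum_lessThan[OF keys(2)]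
    unfolding image_exponent_eq_iff Suc by simp
  moreover have "(\<Sum>l<N. ?a (Suc l)) = (\<Sum>l<N. ?c (Suc l))"
    using high by (intro sum.cong) auto
  ultimately have "?a 0 = ?c 0"
    unfolding sum.lessThan_Suc_shift by simp
  with high have "?a l = ?c l" if "l < n" for l
    using that Suc by (cases l) auto
  moreover have "Poly_Mapping.lookup m k = 0 \<and> Poly_Mapping.lookup m' k = 0" if "k \<notin> {1..n}" for k
    using that keys by (auto simp: in_keys_iff)
  ultimately show ?thesis
    by (intro poly_mapping_eqI) (metis atLeastAtMost_iff Suc_le_D One_nat_def Suc_le_eq)
qed

text \<open>
  The replacements preserve the degree, so this bound makes them terminate.
\<close>

lemma lift_weight_le:
  assumes "Poly_Mapping.keys m \<subseteq> {1..n}"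
  shows "lift_weight b m \<le> (b + 1) ^ n * mdeg m"
proof -
  have "lift_weight b m \<le> (\<Sum>k\<in>Poly_Mapping.keys m. Poly_Mapping.lookup m k * (b + 1) ^ n)"
    unfolding weight_def using assms by (intro sum_mono mult_left_mono power_increasing) auto
  then show ?thesis by (simp add: weight_def sum_distrib_left mult.commute)
qed

lemma exists_reduced:
  fixes I :: "(nat, 'k::comm_ring_1) mpoly set"
  assumes b: "b \<ge> 1" and I: "ideal I (source_ring n)" "minors 2 (Y_matrix b n) \<subseteq> I"
    and "Poly_Mapping.keys m \<subseteq> {1..n}"
  shows "\<exists>m'. reduced b n m' \<and> Poly_Mapping.keys m' \<subseteq> {1..n} \<and> monom m - monom m' \<in> I"
  using assms(4)
proof (induction "(b + 1) ^ n * mdeg m - lift_weight b m" arbitrary: m rule: less_induct)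
  case less
  show ?case
  proof (cases "reduced b n m")
    case True
    then show ?thesis using less.prems ideal_poly_ring_zero[OF I(1)] by (intro exI[of _ m]) simp
  next
    case False
    then obtain i j q where ij: "column_pair n i j" and m: "m = anti_term b i j + q"
      by (auto simp: reduced_def)
    define l where "l = diag_term b i j + q"
    have keys: "Poly_Mapping.keys q \<subseteq> {1..n}" "Poly_Mapping.keys l \<subseteq> {1..n}"
      using less.prems keys_minor_terms[OF ij, of b] by (auto simp: m l_def keys_nat_add)
    have "lift_weight b m < lift_weight b l"
      using lift_weight_anti_less_diag[OF b ij] by (simp add: m l_def)
    moreover have "mdeg l = mdeg m" by (simp add: m l_def)
    ultimately have "(b + 1) ^ n * mdeg l - lift_weight b l < (b + 1) ^ n * mdeg m - lift_weight b m"
      using lift_weight_le[OF keys(2), of b] by simp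
    then obtain m' where m': "reduced b n m'" "Poly_Mapping.keys m' \<subseteq> {1..n}" "monom l - monom m' \<in> I"
      using less.hyps keys(2) by blast
    have "monom (diag_term b i j) - monom (anti_term b i j) \<in> I"
      using I(2) ij by (auto simp: minors_Y_matrix)
    then have "(Const (- 1) * monom q) * (monom (diag_term b i j) - monom (anti_term b i j)) \<in> I"
      by (intro ideal_poly_ring_mult[OF I(1)] mult_in_poly_ring Const_in_poly_ring monom_in_poly_ring keys(1))
    also have "(Const (- 1) * monom q) * (monom (diag_term b i j) - monom (anti_term b i j))
        = (monom m - monom l :: (nat, 'k) mpoly)"
      by (simp add: Const_def m l_def mult_single right_diff_distrib single_uminus add.commute)
    finally have "(monom m - monom l) + (monom l - monom m') \<in> I"
      using m'(3) by (intro ideal_poly_ring_add[OF I(1)])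
    then show ?thesis using m' by (intro exI[of _ m']) simp
  qed
qed

lemma exists_reduced_poly:
  fixes I :: "(nat, 'k::comm_ring_1) mpoly set"
  assumes b: "b \<ge> 1" and I: "ideal I (source_ring n)" "minors 2 (Y_matrix b n) \<subseteq> I"
    and p: "p \<in> carrier (source_ring n)"
  obtains q where "q \<in> carrier (source_ring n)" "p - q \<in> I"
    "\<And>m. m \<in> Poly_Mapping.keys q \<Longrightarrow> reduced b n m"
proof -
  have "\<forall>m\<in>Poly_Mapping.keys p. \<exists>m'. reduced b n m' \<and> Poly_Mapping.keys m' \<subseteq> {1..n} \<and> monom m - monom m' \<in> I"
    using p by (intro ballI exists_reduced[OF b I]) (auto simp: in_poly_ring_iff)
  then obtain f where f: "\<And>m. m \<in> Poly_Mapping.keys p \<Longrightarrow>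
      reduced b n (f m) \<and> Poly_Mapping.keys (f m) \<subseteq> {1..n} \<and> monom m - monom (f m) \<in> I"
    by metis
  define q where "q = (\<Sum>m\<in>Poly_Mapping.keys p. Poly_Mapping.single (f m) (Poly_Mapping.lookup p m))"
  have keys: "Poly_Mapping.keys q \<subseteq> f ` Poly_Mapping.keys p"
    unfolding q_def by (rule order_trans[OF keys_sum]) (auto split: if_splits)
  have "p = (\<Sum>m\<in>Poly_Mapping.keys p. Poly_Mapping.single m (Poly_Mapping.lookup p m))"
    by (intro poly_mapping_eqI) (auto simp: lookup_sum lookup_single when_def in_keys_iff)
  then have "p - q = (\<Sum>m\<in>Poly_Mapping.keys p. Const (Poly_Mapping.lookup p m) * (monom m - monom (f m)))"
    by (simp add: q_def sum_subtractf right_diff_distrib Const_def mult_single)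
  also have "\<dots> \<in> I"
    using f by (intro ideal_poly_ring_sum[OF I(1)] ideal_poly_ring_mult[OF I(1)] Const_in_poly_ring) auto
  finally show thesis
    using that[of q] keys f by (fastforce simp: in_poly_ring_iff)
qed

lemma curve_ideal_reduced_keys_imp_zero:
  assumes p: "p \<in> curve_ideal b n" and red: "\<And>m. m \<in> Poly_Mapping.keys p \<Longrightarrow> reduced b n m"
  shows "p = 0"
proof -
  have "m \<notin> Poly_Mapping.keys p" for m
  proof
    assume "m \<in> Poly_Mapping.keys p"
    then obtain m' where "m' \<in> Poly_Mapping.keys p" "m' \<noteq> m" "image_exponent b m' = image_exponent b m"
      using curve_ideal_key_not_alone[OF p] by blast
    with \<open>m \<in> Poly_Mapping.keys p\<close> show False
      using reduced_unique red curve_ideal_key_closed[OF p] by metis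
  qed
  then show ?thesis by (intro poly_mapping_eqI) (simp add: in_keys_iff)
qed

lemma reduced_low_degree:
  assumes "mdeg m \<le> b"
  shows "reduced b n m"
  using assms by (auto simp: reduced_def)

text \<open>
  In degree at most \<open>b\<close> every monomial is reduced, so each fibre is a single monomial there.
\<close>

lemma curve_ideal_key_degree:
  assumes "p \<in> curve_ideal b n" "m \<in> Poly_Mapping.keys p"
  shows "b + 1 \<le> mdeg m"
proof (rule ccontr)
  assume low: "\<not> ?thesis"
  obtain m' where m': "m' \<in> Poly_Mapping.keys p" "m' \<noteq> m" "image_exponent b m' = image_exponent b m"
    using curve_ideal_key_not_alone[OF assms] by blast
  then have "mdeg m' = mdeg m" by (simp add: image_exponent_eq_iff)
  with low have "reduced b n m" "reduced b n m'" by (auto intro: reduced_low_degree)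
  then show False
    using reduced_unique m' assms curve_ideal_key_closed[OF assms(1)] by metis
qed


section \<open>The minors generate the kernel minimally\<close>

lemma minor_in_curve_ideal:
  assumes "column_pair n i j"
  shows "monom (diag_term b i j) - monom (anti_term b i j) \<in> curve_ideal b n"
  using image_exponent_minor_terms[OF assms, of b] keys_minor_terms[OF assms, of b]
  by (simp add: curve_ideal_eq diff_in_poly_ring monom_in_poly_ring curve_hom_diff curve_hom_single)

lemma minors_in_carrier: "minors 2 (Y_matrix b n) \<subseteq> carrier (source_ring n)"
  using minor_in_curve_ideal by (fastforce simp: minors_Y_matrix curve_ideal_eq)

lemma curve_ideal_generated_by_minors:
  assumes "b \<ge> 1"
  shows "genideal (source_ring n) (minors 2 (Y_matrix b n)) =
    (curve_ideal b n :: (nat, 'k::comm_ring_1) mpoly set)"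
proof
  let ?I = "genideal (source_ring n) (minors 2 (Y_matrix b n)) :: (nat, 'k) mpoly set"
  show sub: "?I \<subseteq> curve_ideal b n"
    using minor_in_curve_ideal
    by (intro genideal_poly_ring_minimal ideal_curve_ideal) (auto simp: minors_Y_matrix)
  show "curve_ideal b n \<subseteq> ?I"
  proof
    fix p :: "(nat, 'k) mpoly" assume p: "p \<in> curve_ideal b n"
    then have "p \<in> carrier (source_ring n)" by (simp add: curve_ideal_eq)
    then obtain q where q: "q \<in> carrier (source_ring n)" "p - q \<in> ?I"
      "\<And>m. m \<in> Poly_Mapping.keys q \<Longrightarrow> reduced b n m"
      using exists_reduced_poly[OF assms] genideal_ideal_poly_ring[OF minors_in_carrier]
        genideal_poly_ring_self[OF minors_in_carrier] by blast
    have "curve_hom b (p - q) = 0" using q(2) sub by (auto simp: curve_ideal_eq)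
    then have "q \<in> curve_ideal b n" using p q(1) by (simp add: curve_ideal_eq curve_hom_diff)
    then have "q = 0" using curve_ideal_reduced_keys_imp_zero q(3) by blast
    then show "p \<in> ?I" using q(2) by simp
  qed
qed

lemma diag_neq_anti: "b \<ge> 1 \<Longrightarrow> column_pair n i j \<Longrightarrow> diag_term b i j \<noteq> anti_term b i j"
  using lift_weight_anti_less_diag by fastforce

text \<open>
  For \<open>b = 1\<close> several minors can have their terms in one fibre, where they form a chain such as
  \<open>x\<^sub>1 x\<^sub>5, x\<^sub>2 x\<^sub>4, x\<^sub>3\<^sup>2\<close>; the missing minor is a link of the chain, and the coefficient sum over one of the
  two pieces detects it.  In general the minors are the edges of a forest on the monomials, since an
  antidiagonal term determines its minor and \<open>lift_weight\<close> excludes cycles.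
\<close>

lemma minors_minimal:
  fixes C :: "(nat, 'k::comm_ring_1) mpoly set"
  assumes b: "b \<ge> 1" and C: "C \<subset> minors 2 (Y_matrix b n)"
  shows "genideal (source_ring n) C \<noteq> curve_ideal b n"
proof -
  obtain i j where ij: "column_pair n i j"
    and missing: "monom (diag_term b i j) - monom (anti_term b i j) \<notin> C"
    using C by (auto simp: minors_Y_matrix)
  define E where "E = {(anti_term b i j, diag_term b i j) | i j. column_pair n i j}"
  \<comment> \<open>The piece that contains the antidiagonal term when the edge of the missing minor is cut.\<close>
  define S where "S = {m. (m, anti_term b i j) \<in> E\<^sup>*}"
  have "E \<subseteq> (\<lambda>(i, j). (anti_term b i j, diag_term b i j)) ` ({..n} \<times> {..n})"
    by (auto simp: E_def column_pair_def image_iff)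
  then have "finite E" by (rule finite_subset) simp
  moreover have "S \<subseteq> insert (anti_term b i j) (Domain E)"
    by (auto simp: S_def elim: converse_rtranclE)
  ultimately have fin: "finite S" by (auto intro: finite_subset finite_Domain)
  have deg: "mdeg m = b + 1" if "m \<in> S" for m
  proof -
    have "(m, anti_term b i j) \<in> E\<^sup>*" using that by (simp add: S_def)
    then show ?thesis by (cases rule: converse_rtranclE) (auto simp: E_def)
  qed
  have anti: "anti_term b i j \<in> S" by (simp add: S_def)
  have lift: "lift_weight b l \<le> lift_weight b m" if "(l, m) \<in> E\<^sup>*" for l m
    using that
    by (induction rule: rtrancl_induct)
       (auto simp: E_def dest!: lift_weight_anti_less_diag[OF b] intro: order_trans less_imp_le)
  have diag: "diag_term b i j \<notin> S"
    using lift[of "diag_term b i j" "anti_term b i j"] lift_weight_anti_less_diag[OF b ij]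
    by (auto simp: S_def)
  \<comment> \<open>No other edge has just one end in \<open>S\<close>, so all other minors have coefficient sum \<open>1 - 1\<close> or \<open>0 - 0\<close> over \<open>S\<close>.\<close>
  have closed: "anti_term b i' j' \<in> S \<longleftrightarrow> diag_term b i' j' \<in> S"
    if ij': "column_pair n i' j'" and neq: "(i', j') \<noteq> (i, j)" for i' j'
  proof
    assume "diag_term b i' j' \<in> S"
    moreover have "(anti_term b i' j', diag_term b i' j') \<in> E" using ij' by (auto simp: E_def)
    ultimately show "anti_term b i' j' \<in> S" by (auto simp: S_def intro: converse_rtrancl_into_rtrancl)
  next
    assume "anti_term b i' j' \<in> S"
    then have "(anti_term b i' j', anti_term b i j) \<in> E\<^sup>*" by (simp add: S_def)
    then show "diag_term b i' j' \<in> S"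
    proof (cases rule: converse_rtranclE)
      case base
      then show ?thesis using anti_term_inject[OF b ij' ij] neq by auto
    next
      case (step m)
      then obtain i2 j2 where "column_pair n i2 j2" "anti_term b i' j' = anti_term b i2 j2" "m = diag_term b i2 j2"
        by (auto simp: E_def)
      with step(2) show ?thesis using anti_term_inject[OF b ij'] by (auto simp: S_def)
    qed
  qed
  have sum: "(\<Sum>m\<in>S. Poly_Mapping.lookup (monom k - monom l :: (nat, 'k) mpoly) m) =
      (if k \<in> S then 1 else 0) - (if l \<in> S then 1 else 0)" for k l
    using fin by (simp add: lookup_minus lookup_single when_def sum_subtractf)
  have "C \<subseteq> degree_functional_ideal {1..n} (b + 1) S"
  proof
    fix p assume p: "p \<in> C"
    then have "p \<in> minors 2 (Y_matrix b n)" using C by blast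
    then obtain i' j' where ij': "column_pair n i' j'"
      and p_eq: "p = monom (diag_term b i' j') - monom (anti_term b i' j')"
      by (auto simp: minors_Y_matrix)
    have "(i', j') \<noteq> (i, j)" using p missing p_eq by auto
    then have "(\<Sum>m\<in>S. Poly_Mapping.lookup p m) = 0"
      using closed[OF ij'] by (simp only: p_eq sum) simp
    moreover have "p \<in> curve_ideal b n" using minor_in_curve_ideal[OF ij'] p_eq by simp
    ultimately show "p \<in> degree_functional_ideal {1..n} (b + 1) S"
      using curve_ideal_key_degree[of p b n] by (auto simp: degree_functional_ideal_def curve_ideal_eq)
  qed
  then have "genideal (source_ring n) C \<subseteq> degree_functional_ideal {1..n} (b + 1) S"
    using deg by (intro genideal_poly_ring_minimal ideal_degree_functional_ideal)
  moreover have "monom (diag_term b i j) - monom (anti_term b i j)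
      \<notin> (degree_functional_ideal {1..n} (b + 1) S :: (nat, 'k) mpoly set)"
    using anti diag by (simp add: degree_functional_ideal_def sum)
  ultimately show ?thesis using minor_in_curve_ideal[OF ij, of b] by auto
qed

lemma minors_minimally_generate:
  assumes "b \<ge> 1"
  shows "minimally_generates (source_ring n) (minors 2 (Y_matrix b n))
    (curve_ideal b n :: (nat, 'k::comm_ring_1) mpoly set)"
  unfolding minimally_generates_def
  by (intro conjI allI impI minors_in_carrier curve_ideal_generated_by_minors minors_minimal assms)


section \<open>Uniqueness of the binomial generators\<close>

text \<open>
  An antidiagonal term that divides \<open>x\<^sub>i\<^sup>b x\<^sub>j\<^sub>+\<^sub>1\<close> is equal to it, since the degrees agree.  If \<open>b > 1\<close>, the
  variable with exponent at least \<open>b\<close> has the larger index (or is the only variable) in an antidiagonal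
  term and the smaller index in a diagonal one.  For \<open>b = 1\<close> the product \<open>x\<^sub>i x\<^sub>j\<^sub>+\<^sub>1\<close> is
  also the antidiagonal term of the
  columns \<open>i - 1 < j + 1\<close> when these exist, which needs \<open>i \<ge> 2\<close>, \<open>j \<ge> 3\<close> and \<open>n \<ge> 5\<close>.
\<close>

lemma reduced_diag_term:
  assumes "b > 1 \<or> b = 1 \<and> n \<le> 4" "column_pair n i j"
  shows "reduced b n (diag_term b i j)"
  unfolding reduced_def
proof (intro allI impI notI)
  fix i' j' q
  assume ij': "column_pair n i' j'" and eq: "diag_term b i j = anti_term b i' j' + q"
  have "mdeg (diag_term b i j) = mdeg (anti_term b i' j') + mdeg q" unfolding eq by simp
  then have "q = 0" by simp
  have eq': "(if k = i then b else 0) + (if k = j + 1 then 1 else 0) =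
      (if k = j' then b else 0) + (if k = i' + 1 then 1 else 0)" for k
    using arg_cong[OF eq, of "\<lambda>m. Poly_Mapping.lookup m k"] \<open>q = 0\<close>
    by (auto simp: diag_term_def anti_term_def lookup_add lookup_single when_def split: if_splits)
  have less: "1 \<le> i" "i < j" "1 \<le> i'" "i' < j'" "j' < n"
    using assms(2) ij' by (auto simp: column_pair_def)
  show False
  proof (cases "j' = i")
    case True
    then have "i' + 1 \<noteq> i" using eq'[of i] less by auto
    then show False using eq'[of "i' + 1"] less True by auto
  next
    case False
    then have "b = 1" "j' = j + 1" using eq'[of j'] assms(1) by (auto split: if_splits)
    moreover have "i = i' + 1"
      by (rule ccontr) (use eq'[of i] False less \<open>b = 1\<close> in simp)
    ultimately show False using assms(1) less by simp
  qed
qed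

text \<open>
  Two antidiagonal terms in one fibre would belong to two reduced diagonal terms in that fibre.
\<close>

lemma diag_term_fibre:
  assumes b: "b > 1 \<or> b = 1 \<and> n \<le> 4" and ij: "column_pair n i j"
    and m: "Poly_Mapping.keys m \<subseteq> {1..n}" "image_exponent b m = image_exponent b (diag_term b i j)"
      "m \<noteq> diag_term b i j"
  shows "m = anti_term b i j"
proof -
  have red: "\<And>i j. column_pair n i j \<Longrightarrow> reduced b n (diag_term b i j)"
    by (rule reduced_diag_term[OF b])
  have "\<not> reduced b n m"
    using reduced_unique[OF _ red[OF ij] m(1) keys_minor_terms(1)[OF ij] m(2)] m(3) by blast
  then obtain i' j' q where ij': "column_pair n i' j'" and m_eq: "m = anti_term b i' j' + q"
    by (auto simp: reduced_def)
  have "mdeg m = b + 1" using m(2) by (simp add: image_exponent_eq_iff)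
  then have "q = 0" unfolding m_eq by simp
  then have "image_exponent b (diag_term b i' j') = image_exponent b (diag_term b i j)"
    using image_exponent_minor_terms[OF ij', of b] m(2) m_eq by simp
  then have "diag_term b i' j' = diag_term b i j"
    by (intro reduced_unique[of b n] red keys_minor_terms ij ij')
  then show ?thesis using diag_term_inject[of b n i' j' i j] ij ij' b m_eq \<open>q = 0\<close> by auto
qed

text \<open>
  A set of binomials in the kernel without the diagonal term lies in the ideal cut out by the
  vanishing of the coefficient of that term, which does not contain the minor.  So some generator has
  the diagonal term, and its second term is the other element of the fibre.
\<close>

lemma binomial_generators_contain_minor:
  fixes B :: "(nat, 'k::field) mpoly set"
  assumes b: "b > 1 \<or> b = 1 \<and> n \<le> 4" and ij: "column_pair n i j"
    and B: "B \<subseteq> carrier (source_ring n)" "genideal (source_ring n) B = curve_ideal b n"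
      "\<forall>p\<in>B. is_binomial p"
  shows "\<exists>c. c \<noteq> 0 \<and> Const c * (monom (diag_term b i j) - monom (anti_term b i j)) \<in> B"
proof -
  let ?T = "diag_term b i j" and ?L = "anti_term b i j"
  have "b \<ge> 1" using b by linarith
  then have neq: "?T \<noteq> ?L" using ij by (rule diag_neq_anti)
  have BJ: "B \<subseteq> curve_ideal b n" using genideal_poly_ring_self[OF B(1)] B(2) by simp
  obtain p where p: "p \<in> B" "?T \<in> Poly_Mapping.keys p"
  proof (rule ccontr)
    assume "\<not> thesis"
    with that have "\<forall>p\<in>B. ?T \<notin> Poly_Mapping.keys p" by blast
    moreover have "b + 1 \<le> mdeg m" if "p \<in> B" "m \<in> Poly_Mapping.keys p" for p m
      using that BJ curve_ideal_key_degree by blast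
    ultimately have "B \<subseteq> degree_functional_ideal {1..n} (b + 1) {?T}"
      using B(1) by (auto simp: degree_functional_ideal_def in_keys_iff)
    then have "genideal (source_ring n) B \<subseteq> degree_functional_ideal {1..n} (b + 1) {?T}"
      by (intro genideal_poly_ring_minimal ideal_degree_functional_ideal) auto
    moreover have "monom ?T - monom ?L \<notin> (degree_functional_ideal {1..n} (b + 1) {?T} :: (nat, 'k) mpoly set)"
      using neq by (simp add: degree_functional_ideal_def lookup_minus lookup_single when_def)
    ultimately show False using minor_in_curve_ideal[OF ij] B(2) by blast
  qed
  have pJ: "p \<in> curve_ideal b n" using BJ p(1) by blast
  obtain m where m: "m \<in> Poly_Mapping.keys p" "m \<noteq> ?T" "image_exponent b m = image_exponent b ?T"
    using curve_ideal_key_not_alone[OF pJ p(2)] by blast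
  then have "m = ?L" using diag_term_fibre[OF b ij] curve_ideal_key_closed[OF pJ] by blast
  have "card (Poly_Mapping.keys p) = 2" using B(3) p(1) by (simp add: is_binomial_def)
  then have keys: "Poly_Mapping.keys p = {?T, ?L}"
    using card_subset_eq[of "Poly_Mapping.keys p" "{?T, ?L}"] p(2) m(1) \<open>m = ?L\<close> neq by simp
  have "{l\<in>Poly_Mapping.keys p. image_exponent b l = image_exponent b ?T} = {?T, ?L}"
    using keys m(3) \<open>m = ?L\<close> by auto
  then have "Poly_Mapping.lookup p ?T + Poly_Mapping.lookup p ?L = 0"
    using lookup_curve_hom[of b p "image_exponent b ?T"] pJ neq by (simp add: curve_ideal_eq)
  then have L: "Poly_Mapping.lookup p ?L = - Poly_Mapping.lookup p ?T"
    by (simp add: add_eq_0_iff)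
  have "p = Const (Poly_Mapping.lookup p ?T) * (monom ?T - monom ?L)"
  proof (rule poly_mapping_eqI)
    fix l
    show "Poly_Mapping.lookup p l =
        Poly_Mapping.lookup (Const (Poly_Mapping.lookup p ?T) * (monom ?T - monom ?L)) l"
    proof (cases "l \<in> {?T, ?L}")
      case True
      then show ?thesis using neq L by (auto simp: lookup_Const_mult lookup_minus lookup_single when_def)
    next
      case False
      then have "Poly_Mapping.lookup p l = 0" using keys by (metis in_keys_iff)
      then show ?thesis using False by (auto simp: lookup_Const_mult lookup_minus lookup_single when_def)
    qed
  qed
  moreover have "Poly_Mapping.lookup p ?T \<noteq> 0" using p(2) by (simp add: in_keys_iff)
  ultimately show ?thesis using p(1) by metis
qed

lemma is_binomial_minor:
  assumes "b \<ge> 1" "column_pair n i j"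
  shows "is_binomial (monom (diag_term b i j) - monom (anti_term b i j) :: (nat, 'k::comm_ring_1) mpoly)"
proof -
  have "Poly_Mapping.keys (monom (diag_term b i j) - monom (anti_term b i j) :: (nat, 'k) mpoly)
      = {diag_term b i j, anti_term b i j}"
    using diag_neq_anti[OF assms] by (auto simp: in_keys_iff lookup_minus lookup_single when_def split: if_splits)
  then show ?thesis using diag_neq_anti[OF assms] by (simp add: is_binomial_def)
qed

lemma unique_binomial_generators:
  assumes b: "b > 1 \<or> b = 1 \<and> n \<le> 4"
  shows "unique_minimal_binomial_system (source_ring n) (curve_ideal b n :: (nat, 'k::field) mpoly set)"
  unfolding unique_minimal_binomial_system_def
proof (intro exI conjI allI impI)
  let ?M = "minors 2 (Y_matrix b n) :: (nat, 'k) mpoly set" and ?J = "curve_ideal b n :: (nat, 'k) mpoly set"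
  have b1: "b \<ge> 1" using b by auto
  show "minimal_binomial_system (source_ring n) ?M ?J"
    using minors_minimally_generate[OF b1] is_binomial_minor[OF b1]
    by (auto simp: minimal_binomial_system_def minors_Y_matrix)
  fix B assume "minimal_binomial_system (source_ring n) B ?J"
  then have B: "B \<subseteq> carrier (source_ring n)" "genideal (source_ring n) B = ?J" "\<forall>p\<in>B. is_binomial p"
    and min: "\<And>C. C \<subset> B \<Longrightarrow> genideal (source_ring n) C \<noteq> ?J"
    by (auto simp: minimal_binomial_system_def minimally_generates_def)
  have "\<forall>p\<in>?M. \<exists>c. c \<noteq> 0 \<and> Const c * p \<in> B"
    using binomial_generators_contain_minor[OF b _ B] by (auto simp: minors_Y_matrix)
  then obtain c where c: "\<And>p. p \<in> ?M \<Longrightarrow> c p \<noteq> 0 \<and> Const (c p) * p \<in> B" by metis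
  \<comment> \<open>These multiples of the minors generate the kernel already, so by minimality they are all of \<open>B\<close>.\<close>
  define C where "C = (\<lambda>p. Const (c p) * p) ` ?M"
  have CB: "C \<subseteq> B" using c by (auto simp: C_def)
  then have C: "C \<subseteq> carrier (source_ring n)" using B(1) by blast
  have "?M \<subseteq> genideal (source_ring n) C"
  proof
    fix p assume p: "p \<in> ?M"
    then have "Const (c p) * p \<in> genideal (source_ring n) C"
      using genideal_poly_ring_self[OF C] by (auto simp: C_def)
    then have "Const (inverse (c p)) * (Const (c p) * p) \<in> genideal (source_ring n) C"
      by (rule ideal_poly_ring_mult[OF genideal_ideal_poly_ring[OF C] _ Const_in_poly_ring])
    moreover have "Const (inverse (c p)) * (Const (c p) * p) = p"
      using c[OF p] by (simp add: mult.assoc[symmetric] Const_mult[symmetric])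
    ultimately show "p \<in> genideal (source_ring n) C" by (simp only:)
  qed
  then have "?J \<subseteq> genideal (source_ring n) C"
    unfolding curve_ideal_generated_by_minors[OF b1, symmetric]
    by (intro genideal_poly_ring_minimal genideal_ideal_poly_ring C)
  moreover have "genideal (source_ring n) C \<subseteq> ?J"
    using CB genideal_poly_ring_self[OF B(1)] B(2)
    by (intro genideal_poly_ring_minimal ideal_curve_ideal) auto
  ultimately have "C = B" using min[of C] CB by blast
  then show "equal_up_to_scalars ?M B"
    using c unfolding equal_up_to_scalars_def C_def by (intro exI[of _ c]) auto
qed

theorem corollary6:
  fixes b n :: nat
  assumes "b \<ge> 1" and "n > 1"
  shows "minimally_generates (source_ring n) (minors 2 (Y_matrix b n))
           (curve_ideal b n :: (nat, 'k::field) mpoly set)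
       \<and> (b > 1 \<or> n \<le> 4 \<longrightarrow>
            unique_minimal_binomial_system (source_ring n)
              (curve_ideal b n :: (nat, 'k) mpoly set))"
  using minors_minimally_generate[OF assms(1), of n] unique_binomial_generators[of b n] assms(1)
  by (auto simp: le_less)

end
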